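(* Let $K$ be a field, let $\mathcal{V}=(\boldsymbol{v}_1,\dots,\boldsymbol{v}_s)$ be a $d\times s$ integer matrix with columns $\boldsymbol{v}_i\in\mathbb{Z}^d$, and let $S=K[y_1,\dots,y_s]$ be the $\mathbb{Z}^d$-graded polynomial ring with $\deg_{\mathbb{Z}^d}(y_i)=\boldsymbol{v}_i$. Let $\mathfrak{H}\subset\mathbb{Z}^d$ be a finitely generated subsemigroup, and let $\mathcal{A}$ be a system of generators, as a semigroup, of $$\{\boldsymbol{a}={}^t(a_1,\dots,a_s)\in\mathbb{N}^s\mid \mathcal{V}\cdot\boldsymbol{a}\in\mathfrak{H}\}.$$ Suppose that $\mathcal{A}=\{\boldsymbol{a}^{(1)},\dots,\boldsymbol{a}^{(r)}\}$ is a finite set. Let $R=K[x_1,\dots,x_r]$, let $\phi_{\mathcal{A}}:R\to S$ be the $K$-algebra homomorphism $x_j\mapsto \boldsymbol{y}^{\boldsymbol{a}^{(j)}}$, and let $P_{\mathcal{A}}=\operatorname{Ker}\phi_{\mathcal{A}}$. Let $I\subset S$ be a $\mathbb{Z}^d$-graded ideal, and let $m\in\mathbb{N}$. Then the following hold. (1) If both $I$ and $P_{\mathcal{A}}$ admit initial ideals of degree at most $m$, then so does $\phi_{\mathcal{A}}^{-1}(I)$. (2) If both $I$ and $P_{\mathcal{A}}$ admit square-free initial ideals, then so does $\phi_{\mathcal{A}}^{-1}(I)$.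
   Context: $\mathbb{N}=\{0,1,2,\dots\}$, and $\boldsymbol{y}^{\boldsymbol{a}}=y_1^{a_1}\cdots y_s^{a_s}$. Subsemigroups of $\mathbb{Z}^d$ and $\mathbb{N}^s$ are understood to contain $0$, and the semigroup generated by $\{\boldsymbol{a}^{(1)},\dots,\boldsymbol{a}^{(r)}\}$ is $\{\sum_i n_i\boldsymbol{a}^{(i)}\mid n_i\in\mathbb{N}\}$. The vectors $\boldsymbol{a}^{(j)}$ are distinct. A monomial ideal is "of degree at most $m$" (resp. "square-free") if all elements of its minimal system of monomial generators have degree at most $m$ (resp. are square-free). An ideal $J$ of a polynomial ring "admits" an initial ideal with a given property if there is a term order $\prec$ on that ring such that $\operatorname{in}_\prec(J)=\langle \operatorname{in}_\prec(f)\mid f\in J\rangle$ has the property. The term orders for $I$, $P_{\mathcal{A}}$ and $\phi_{\mathcal{A}}^{-1}(I)$ are on $S$, $R$ and $R$ respectively. *)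

theory Defs
  imports
    "Jordan_Normal_Form.Matrix"
    "HOL-Library.Poly_Mapping"
    "HOL-Algebra.Ideal"
    "HOL-Algebra.RingHom"
begin

section \<open>Polynomial rings in finitely many variables\<close>

text \<open>
  Polynomials over \<open>'k\<close> are finitely supported maps from monomials to coefficients, and a monomial
  is identified with its finitely supported exponent map. Variables are indexed by natural numbers,
  starting from 0. The polynomial ring in \<open>n\<close> variables consists of the polynomials in which only
  variables with index below \<open>n\<close> occur; \<open>n = 0\<close> is allowed and gives the ring of constants.
\<close>

type_synonym mon = "nat \<Rightarrow>\<^sub>0 nat"
type_synonym 'k mpoly = "mon \<Rightarrow>\<^sub>0 'k"

definition monomials :: "nat \<Rightarrow> mon set" where
  "monomials n = {u. Poly_Mapping.keys u \<subseteq> {..<n}}"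

definition mpoly_ring :: "nat \<Rightarrow> 'k::field mpoly ring" where
  "mpoly_ring n = \<lparr>carrier = {p. Poly_Mapping.keys p \<subseteq> monomials n}, mult = (*), one = 1, zero = 0, add = (+)\<rparr>"

definition mon_poly :: "mon \<Rightarrow> 'k::field mpoly" where
  "mon_poly u = Poly_Mapping.single u 1"

definition const_poly :: "'k::field \<Rightarrow> 'k mpoly" where
  "const_poly c = Poly_Mapping.single 0 c"

definition var_poly :: "nat \<Rightarrow> 'k::field mpoly" where
  "var_poly i = mon_poly (Poly_Mapping.single i 1)"

definition mon_degree :: "mon \<Rightarrow> nat" where
  "mon_degree u = (\<Sum>i\<in>Poly_Mapping.keys u. Poly_Mapping.lookup u i)"

definition mon_squarefree :: "mon \<Rightarrow> bool" where
  "mon_squarefree u \<longleftrightarrow> (\<forall>i. Poly_Mapping.lookup u i \<le> 1)"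

definition poly_subst :: "(nat \<Rightarrow> 'k::field mpoly) \<Rightarrow> 'k mpoly \<Rightarrow> 'k mpoly" where
  "poly_subst g p = (\<Sum>u\<in>Poly_Mapping.keys p. const_poly (Poly_Mapping.lookup p u) * (\<Prod>i\<in>Poly_Mapping.keys u. g i ^ Poly_Mapping.lookup u i))"


section \<open>Initial ideals\<close>

text \<open>
  A pair \<open>(u, v) \<in> ord\<close> means that \<open>u\<close> is less than or equal to \<open>v\<close>.
\<close>

definition term_order :: "nat \<Rightarrow> mon rel \<Rightarrow> bool" where
  "term_order n ord \<longleftrightarrow>
     linear_order_on (monomials n) ord \<and>
     (\<forall>u\<in>monomials n. (0, u) \<in> ord) \<and>
     (\<forall>u\<in>monomials n. \<forall>v\<in>monomials n. \<forall>w\<in>monomials n.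
        (u, v) \<in> ord \<longrightarrow> (u + w, v + w) \<in> ord)"

definition lead_mon :: "mon rel \<Rightarrow> 'k::field mpoly \<Rightarrow> mon" where
  "lead_mon ord f = (THE u. u \<in> Poly_Mapping.keys f \<and> (\<forall>v\<in>Poly_Mapping.keys f. (v, u) \<in> ord))"

definition initial_form :: "mon rel \<Rightarrow> 'k::field mpoly \<Rightarrow> 'k mpoly" where
  "initial_form ord f = (if f = 0 then 0 else mon_poly (lead_mon ord f))"

definition initial_ideal :: "nat \<Rightarrow> mon rel \<Rightarrow> 'k::field mpoly set \<Rightarrow> 'k mpoly set" where
  "initial_ideal n ord J = Idl\<^bsub>mpoly_ring n\<^esub> {initial_form ord f | f. f \<in> J}"

definition generated_by_monomials :: "nat \<Rightarrow> 'k::field mpoly set \<Rightarrow> mon set \<Rightarrow> bool" where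
  "generated_by_monomials n M G \<longleftrightarrow>
     G \<subseteq> monomials n \<and> Idl\<^bsub>mpoly_ring n\<^esub> (mon_poly ` G) = M"

definition minimal_monomial_generators :: "nat \<Rightarrow> 'k::field mpoly set \<Rightarrow> mon set \<Rightarrow> bool" where
  "minimal_monomial_generators n M G \<longleftrightarrow>
     generated_by_monomials n M G \<and> (\<forall>G'. G' \<subset> G \<longrightarrow> \<not> generated_by_monomials n M G')"

text \<open>
  The minimal system of monomial generators of a monomial ideal exists and is unique. The existential
  quantifier also makes the following two predicates false for ideals that are not monomial.
\<close>

definition monomial_ideal_of_degree_at_most ::
    "nat \<Rightarrow> nat \<Rightarrow> 'k::field mpoly set \<Rightarrow> bool" where
  "monomial_ideal_of_degree_at_most n m M \<longleftrightarrow>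
     (\<exists>G. minimal_monomial_generators n M G \<and> (\<forall>u\<in>G. mon_degree u \<le> m))"

definition squarefree_monomial_ideal :: "nat \<Rightarrow> 'k::field mpoly set \<Rightarrow> bool" where
  "squarefree_monomial_ideal n M \<longleftrightarrow>
     (\<exists>G. minimal_monomial_generators n M G \<and> (\<forall>u\<in>G. mon_squarefree u))"

definition admits_initial_ideal ::
    "nat \<Rightarrow> ('k::field mpoly set \<Rightarrow> bool) \<Rightarrow> 'k mpoly set \<Rightarrow> bool" where
  "admits_initial_ideal n Q J \<longleftrightarrow> (\<exists>ord. term_order n ord \<and> Q (initial_ideal n ord J))"


section \<open>Semigroups and multigradings\<close>

text \<open>
  All linear combinations of \<open>G\<close> with natural number coefficients. Used for \<open>'a = int\<close> and
  \<open>'a = nat\<close>, with \<open>G\<close> a finite set of vectors of dimension \<open>n\<close>.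
\<close>

definition semigroup_generated :: "nat \<Rightarrow> 'a::comm_semiring_1 vec set \<Rightarrow> 'a vec set" where
  "semigroup_generated n G =
     {finsum_vec TYPE('a) n (\<lambda>g. of_nat (c g) \<cdot>\<^sub>v g) G | c :: 'a vec \<Rightarrow> nat. True}"

definition finitely_generated_semigroup :: "nat \<Rightarrow> 'a::comm_semiring_1 vec set \<Rightarrow> bool" where
  "finitely_generated_semigroup n H \<longleftrightarrow>
     (\<exists>G. finite G \<and> G \<subseteq> carrier_vec n \<and> H = semigroup_generated n G)"

definition mon_of_vec :: "nat vec \<Rightarrow> mon" where
  "mon_of_vec a = (\<Sum>i<dim_vec a. Poly_Mapping.single i (a $ i))"

definition vec_of_mon :: "nat \<Rightarrow> mon \<Rightarrow> nat vec" where
  "vec_of_mon n u = vec n (Poly_Mapping.lookup u)"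

definition multidegree :: "int mat \<Rightarrow> mon \<Rightarrow> int vec" where
  "multidegree V u = V *\<^sub>v map_vec int (vec_of_mon (dim_col V) u)"

definition homogeneous_component :: "int mat \<Rightarrow> int vec \<Rightarrow> 'k::field mpoly \<Rightarrow> 'k mpoly" where
  "homogeneous_component V h f =
     (\<Sum>u\<in>{u \<in> Poly_Mapping.keys f. multidegree V u = h}. Poly_Mapping.single u (Poly_Mapping.lookup f u))"

definition graded_ideal :: "int mat \<Rightarrow> 'k::field mpoly set \<Rightarrow> bool" where
  "graded_ideal V I \<longleftrightarrow>
     ideal I (mpoly_ring (dim_col V)) \<and>
     (\<forall>f\<in>I. \<forall>h\<in>carrier_vec (dim_row V). homogeneous_component V h f \<in> I)"

text \<open>
  The algebra homomorphism sending the variable with index \<open>j\<close> to the monomial with exponent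
  vector \<open>a j\<close>.
\<close>

definition toric_hom :: "(nat \<Rightarrow> nat vec) \<Rightarrow> 'k::field mpoly \<Rightarrow> 'k mpoly" where
  "toric_hom a = poly_subst (\<lambda>j. mon_poly (mon_of_vec (a j)))"

definition toric_ideal :: "nat \<Rightarrow> nat \<Rightarrow> (nat \<Rightarrow> nat vec) \<Rightarrow> 'k::field mpoly set" where
  "toric_ideal r s a = a_kernel (mpoly_ring r) (mpoly_ring s) (toric_hom a)"

definition toric_preimage :: "nat \<Rightarrow> (nat \<Rightarrow> nat vec) \<Rightarrow> 'k::field mpoly set \<Rightarrow> 'k mpoly set" where
  "toric_preimage r a I = {f \<in> carrier (mpoly_ring r). toric_hom a f \<in> I}"


section \<open>Basic properties\<close>

lemma mpoly_ring_simps [simp]: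
  "carrier (mpoly_ring n) = {p. Poly_Mapping.keys p \<subseteq> monomials n}"
  "x \<otimes>\<^bsub>mpoly_ring n\<^esub> y = x * y"
  "x \<oplus>\<^bsub>mpoly_ring n\<^esub> y = x + y"
  "\<one>\<^bsub>mpoly_ring n\<^esub> = 1"
  "\<zero>\<^bsub>mpoly_ring n\<^esub> = 0"
  by (simp_all add: mpoly_ring_def)

lemma monomials_zero: "0 \<in> monomials n"
  by (simp add: monomials_def)

lemma monomials_add: "u \<in> monomials n \<Longrightarrow> v \<in> monomials n \<Longrightarrow> u + v \<in> monomials n"
  using Poly_Mapping.keys_add[of u v] by (auto simp: monomials_def)

lemma mpoly_add_closed:
  "Poly_Mapping.keys (p :: 'k::field mpoly) \<subseteq> monomials n \<Longrightarrow> Poly_Mapping.keys q \<subseteq> monomials n \<Longrightarrow> Poly_Mapping.keys (p + q) \<subseteq> monomials n"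
  using Poly_Mapping.keys_add[of p q] by auto

lemma mpoly_mult_closed:
  "Poly_Mapping.keys (p :: 'k::field mpoly) \<subseteq> monomials n \<Longrightarrow> Poly_Mapping.keys q \<subseteq> monomials n \<Longrightarrow> Poly_Mapping.keys (p * q) \<subseteq> monomials n"
  using keys_mult[of p q] monomials_add by fastforce

lemma mpoly_one_closed: "Poly_Mapping.keys (1 :: 'k::field mpoly) \<subseteq> monomials n"
  by (simp add: monomials_zero)

lemma cring_mpoly_ring: "cring (mpoly_ring n :: 'k::field mpoly ring)"
proof (rule cringI)
  show "abelian_group (mpoly_ring n :: 'k mpoly ring)"
  proof (rule abelian_groupI)
    fix x :: "'k mpoly" assume "x \<in> carrier (mpoly_ring n)"
    then show "\<exists>y\<in>carrier (mpoly_ring n). y \<oplus>\<^bsub>mpoly_ring n\<^esub> x = \<zero>\<^bsub>mpoly_ring n\<^esub>"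
      by (intro bexI[of _ "- x"]) auto
  qed (auto simp: algebra_simps dest: mpoly_add_closed)
  show "comm_monoid (mpoly_ring n :: 'k mpoly ring)"
    by (rule comm_monoidI) (auto simp: algebra_simps monomials_zero dest: mpoly_mult_closed)
qed (auto simp: algebra_simps)

lemma poly_subst_superset:
  assumes "finite U" "Poly_Mapping.keys p \<subseteq> U"
  shows "poly_subst g p = (\<Sum>u\<in>U. const_poly (Poly_Mapping.lookup p u) * (\<Prod>i\<in>Poly_Mapping.keys u. g i ^ Poly_Mapping.lookup u i))"
  unfolding poly_subst_def
  by (rule sum.mono_neutral_left) (use assms in \<open>auto simp: const_poly_def in_keys_iff\<close>)

lemma poly_subst_add: "poly_subst g (p + q) = poly_subst g p + poly_subst g q"
proof -
  let ?U = "Poly_Mapping.keys p \<union> Poly_Mapping.keys q"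
  have "poly_subst g (p + q) = (\<Sum>u\<in>?U. const_poly (Poly_Mapping.lookup (p + q) u) * (\<Prod>i\<in>Poly_Mapping.keys u. g i ^ Poly_Mapping.lookup u i))"
    by (rule poly_subst_superset) (use Poly_Mapping.keys_add[of p q] in auto)
  also have "\<dots> = poly_subst g p + poly_subst g q"
    by (simp add: poly_subst_superset[of ?U p] poly_subst_superset[of ?U q] const_poly_def
        lookup_add single_add distrib_right sum.distrib)
  finally show ?thesis .
qed

lemma poly_subst_single:
  "poly_subst g (Poly_Mapping.single u c) = const_poly c * (\<Prod>i\<in>Poly_Mapping.keys u. g i ^ Poly_Mapping.lookup u i)"
  by (simp add: poly_subst_def const_poly_def)

lemma poly_subst_const [simp]: "poly_subst g (const_poly c) = const_poly c"
  unfolding const_poly_def[of c] by (subst poly_subst_single) (simp add: const_poly_def)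

lemma poly_subst_var [simp]: "poly_subst g (var_poly i) = g i"
  by (simp add: var_poly_def mon_poly_def poly_subst_single const_poly_def)

lemma power_prod_add:
  fixes g :: "nat \<Rightarrow> 'k::field mpoly" and u v :: mon
  shows "(\<Prod>i\<in>Poly_Mapping.keys (u + v). g i ^ Poly_Mapping.lookup (u + v) i) =
    (\<Prod>i\<in>Poly_Mapping.keys u. g i ^ Poly_Mapping.lookup u i) * (\<Prod>i\<in>Poly_Mapping.keys v. g i ^ Poly_Mapping.lookup v i)"
proof -
  let ?U = "Poly_Mapping.keys u \<union> Poly_Mapping.keys v"
  have *: "(\<Prod>i\<in>Poly_Mapping.keys w. g i ^ Poly_Mapping.lookup w i) = (\<Prod>i\<in>?U. g i ^ Poly_Mapping.lookup w i)"
    if "Poly_Mapping.keys w \<subseteq> ?U" for w :: mon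
    by (rule prod.mono_neutral_left) (use that in \<open>auto simp: in_keys_iff\<close>)
  show ?thesis
    unfolding *[OF Poly_Mapping.keys_add[of u v]]
    by (simp only: *[of u, OF Un_upper1] *[of v, OF Un_upper2] lookup_add power_add prod.distrib)
qed

lemma poly_mapping_sum_single: "(p :: 'k::field mpoly) = (\<Sum>u\<in>Poly_Mapping.keys p. Poly_Mapping.single u (Poly_Mapping.lookup p u))"
  by (rule poly_mapping_eqI) (simp add: lookup_sum lookup_single when_def in_keys_iff)

lemma poly_subst_zero: "poly_subst g 0 = 0"
  by (simp add: poly_subst_def)

lemma poly_subst_sum: "poly_subst g (sum h A) = (\<Sum>x\<in>A. poly_subst g (h x))"
  by (induction A rule: infinite_finite_induct) (simp_all add: poly_subst_add poly_subst_zero)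

lemma poly_subst_mult: "poly_subst g (p * q) = poly_subst g p * poly_subst g q"
proof -
  have single: "poly_subst g (Poly_Mapping.single u c * Poly_Mapping.single v d) =
      poly_subst g (Poly_Mapping.single u c) * poly_subst g (Poly_Mapping.single v d)" for u v c d
  proof -
    have "const_poly (c * d) = const_poly c * const_poly d"
      by (simp add: const_poly_def mult_single)
    then show ?thesis
      by (simp add: mult_single poly_subst_single power_prod_add mult_ac)
  qed
  have "poly_subst g ((\<Sum>u\<in>Poly_Mapping.keys p. Poly_Mapping.single u (Poly_Mapping.lookup p u)) *
      (\<Sum>v\<in>Poly_Mapping.keys q. Poly_Mapping.single v (Poly_Mapping.lookup q v))) =
      poly_subst g (\<Sum>u\<in>Poly_Mapping.keys p. Poly_Mapping.single u (Poly_Mapping.lookup p u)) *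
      poly_subst g (\<Sum>v\<in>Poly_Mapping.keys q. Poly_Mapping.single v (Poly_Mapping.lookup q v))"
    by (simp only: sum_product poly_subst_sum single)
  then show ?thesis
    by (simp only: poly_mapping_sum_single[symmetric])
qed

lemma poly_subst_one: "poly_subst g 1 = 1"
  using poly_subst_const[of g 1] by (simp add: const_poly_def)

lemma poly_subst_closed:
  assumes "Poly_Mapping.keys (p :: 'k::field mpoly) \<subseteq> monomials r"
    and "\<And>j. j < r \<Longrightarrow> Poly_Mapping.keys (g j) \<subseteq> monomials s"
  shows "Poly_Mapping.keys (poly_subst g p) \<subseteq> monomials s"
proof -
  have pow: "Poly_Mapping.keys (g j ^ k) \<subseteq> monomials s" if "j < r" for j k
  proof (induction k)
    case 0
    then show ?case using mpoly_one_closed by simp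
  next
    case (Suc k)
    then show ?case using mpoly_mult_closed[OF assms(2)[OF that]] by simp
  qed
  have prd: "Poly_Mapping.keys (\<Prod>i\<in>A. g i ^ Poly_Mapping.lookup u i) \<subseteq> monomials s"
    if "A \<subseteq> {..<r}" for A and u :: mon
    using that
  proof (induction A rule: infinite_finite_induct)
    case (insert i A)
    then have "Poly_Mapping.keys (g i ^ Poly_Mapping.lookup u i * (\<Prod>i\<in>A. g i ^ Poly_Mapping.lookup u i)) \<subseteq> monomials s"
      by (intro mpoly_mult_closed pow) auto
    then show ?case using insert.hyps by simp
  qed (use mpoly_one_closed in simp_all)
  have con: "Poly_Mapping.keys (const_poly c) \<subseteq> monomials s" for c :: 'k
    by (simp add: const_poly_def monomials_zero)
  have "Poly_Mapping.keys (\<Sum>u\<in>U. const_poly (Poly_Mapping.lookup p u) * (\<Prod>i\<in>Poly_Mapping.keys u. g i ^ Poly_Mapping.lookup u i)) \<subseteq> monomials s"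
    if "U \<subseteq> monomials r" for U
    using that
  proof (induction U rule: infinite_finite_induct)
    case (insert u U)
    have "Poly_Mapping.keys u \<subseteq> {..<r}"
      using insert.prems by (simp add: monomials_def)
    then have "Poly_Mapping.keys (const_poly (Poly_Mapping.lookup p u) *
        (\<Prod>i\<in>Poly_Mapping.keys u. g i ^ Poly_Mapping.lookup u i)) \<subseteq> monomials s"
      by (intro mpoly_mult_closed con prd)
    from mpoly_add_closed[OF this insert.IH] show ?case
      using insert.prems insert.hyps by simp
  qed simp_all
  then show ?thesis
    using assms(1) by (simp add: poly_subst_def)
qed

lemma mon_of_vec_in_monomials: "a \<in> carrier_vec s \<Longrightarrow> mon_of_vec a \<in> monomials s"
  using keys_sum[of "\<lambda>i. Poly_Mapping.single i (a $ i)" "{..<s}"]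
  by (fastforce simp: mon_of_vec_def monomials_def split: if_splits)

lemma lookup_mon_of_vec: "Poly_Mapping.lookup (mon_of_vec a) i = (if i < dim_vec a then a $ i else 0)"
  by (auto simp: mon_of_vec_def lookup_sum lookup_single when_def)

lemma toric_hom_var: "toric_hom a (var_poly j) = mon_poly (mon_of_vec (a j))"
  by (simp add: toric_hom_def)

lemma toric_hom_const: "toric_hom a (const_poly c) = const_poly c"
  by (simp add: toric_hom_def)

lemma toric_hom_ring_hom:
  assumes "a ` {..<r} \<subseteq> carrier_vec s"
  shows "(toric_hom a :: 'k::field mpoly \<Rightarrow> 'k mpoly) \<in> ring_hom (mpoly_ring r) (mpoly_ring s)"
proof (rule ring_hom_memI)
  fix p :: "'k mpoly" assume "p \<in> carrier (mpoly_ring r)"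
  then show "toric_hom a p \<in> carrier (mpoly_ring s)"
    unfolding toric_hom_def mpoly_ring_simps mem_Collect_eq
    by (rule poly_subst_closed) (use assms in \<open>auto simp: mon_poly_def intro!: mon_of_vec_in_monomials\<close>)
qed (simp_all add: toric_hom_def poly_subst_add poly_subst_mult poly_subst_one)

end

theory Submission
  imports Defs "HOL-Algebra.QuotRing"
begin

text \<open>
  Write \<open>\<phi>\<close> for the toric homomorphism \<open>R \<rightarrow> S\<close>. It sends monomials to monomials, so it also acts
  on exponents (\<open>toric_exponent\<close>). Let \<open>ord1\<close> and \<open>ord2\<close> be term orders on \<open>S\<close> and \<open>R\<close> for which
  \<open>I\<close> and the toric ideal \<open>P\<close> have good initial ideals. On \<open>R\<close> compare two monomials by applying
  \<open>ord1\<close> to their images under \<open>\<phi>\<close>, and break ties by \<open>ord2\<close>. For this order a monomial \<open>u\<close> of \<open>R\<close>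
  is the leading monomial of an element of the preimage of \<open>I\<close> if and only if \<open>u\<close> is a leading
  monomial of \<open>P\<close>, or \<open>\<phi>(u)\<close> is a leading monomial of \<open>I\<close>.

  For the forward direction, let \<open>u\<close> be the leading monomial of \<open>f\<close>, with \<open>\<phi>(f) \<in> I\<close>, and look at the
  terms of \<open>f\<close> that have the same image as \<open>u\<close>. If their images cancel, these terms form an element
  of \<open>P\<close>; otherwise \<open>\<phi>(u)\<close> survives as the leading monomial of \<open>\<phi>(f)\<close>
  (\<open>lead_monomials_toric_preimage_cases\<close>). Conversely, a leading monomial of \<open>P\<close> is also the leading
  monomial of an element of \<open>P\<close> whose terms all have the same image
  (\<open>lead_monomials_toric_ideal_subset\<close>). And if \<open>\<phi>(u)\<close> leads \<open>g \<in> I\<close>, then \<open>g\<close> may be replaced by its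
  homogeneous component of degree \<open>deg \<phi>(u)\<close>. This degree lies in the semigroup \<open>H\<close>, hence every
  monomial of that component is in the image of \<open>\<phi>\<close>, and the component lifts to a polynomial led by
  \<open>u\<close> (\<open>lead_monomials_pullback_subset\<close>). This is where the grading of \<open>I\<close> and the choice of the
  generators of the semigroup enter.

  An initial ideal has minimal generators with a property \<open>Q\<close> exactly when every leading monomial is
  divisible by a leading monomial with \<open>Q\<close> (\<open>minimal_generators_initial_ideal_iff\<close>). So it remains to
  find, for a leading monomial \<open>v\<close> of \<open>I\<close> with \<open>Q\<close> that divides \<open>\<phi>(u)\<close>, a divisor \<open>u'\<close> of \<open>u\<close> with \<open>Q\<close>
  such that \<open>v\<close> still divides \<open>\<phi>(u')\<close>. For a degree bound, each variable of \<open>v\<close>, counted with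
  multiplicity, needs at most one further variable of \<open>u\<close> (\<open>cover_by_small_divisor\<close>). For
  square-freeness, the radical of \<open>u\<close> works, because \<open>\<phi>\<close> of it has the same support as \<open>\<phi>(u)\<close>
  (\<open>cover_by_radical\<close>).
\<close>

section \<open>Divisibility of monomials\<close>

definition mon_dvd :: "mon \<Rightarrow> mon \<Rightarrow> bool" where
  "mon_dvd g u \<longleftrightarrow> (\<exists>w. u = g + w)"

lemma mon_dvd_iff: "mon_dvd g u \<longleftrightarrow> (\<forall>i. Poly_Mapping.lookup g i \<le> Poly_Mapping.lookup u i)"
proof
  assume *: "\<forall>i. Poly_Mapping.lookup g i \<le> Poly_Mapping.lookup u i"
  have "u = g + (u - g)"
    by (rule poly_mapping_eqI) (simp add: lookup_add lookup_minus *)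
  then show "mon_dvd g u" unfolding mon_dvd_def by blast
qed (auto simp: mon_dvd_def lookup_add)

lemma mon_dvd_refl: "mon_dvd u u"
  by (simp add: mon_dvd_iff)

lemma mon_dvd_trans: "mon_dvd u v \<Longrightarrow> mon_dvd v w \<Longrightarrow> mon_dvd u w"
  by (meson mon_dvd_iff order_trans)

lemma keys_add_mon: "Poly_Mapping.keys (u + v :: mon) = Poly_Mapping.keys u \<union> Poly_Mapping.keys v"
  by (auto simp: in_keys_iff lookup_add)

lemma add_in_monomials_iff: "u + v \<in> monomials n \<longleftrightarrow> u \<in> monomials n \<and> v \<in> monomials n"
  by (simp add: monomials_def keys_add_mon)

lemma mon_dvd_monomials: "mon_dvd g u \<Longrightarrow> u \<in> monomials n \<Longrightarrow> g \<in> monomials n"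
  by (auto simp: mon_dvd_def add_in_monomials_iff)

lemma mon_degree_superset:
  "finite U \<Longrightarrow> Poly_Mapping.keys u \<subseteq> U \<Longrightarrow> mon_degree u = (\<Sum>i\<in>U. Poly_Mapping.lookup u i)"
  unfolding mon_degree_def by (rule sum.mono_neutral_left) (auto simp: in_keys_iff)

lemma mon_degree_add: "mon_degree (u + v) = mon_degree u + mon_degree v"
proof -
  let ?U = "Poly_Mapping.keys u \<union> Poly_Mapping.keys v"
  have "mon_degree (u + v) = (\<Sum>i\<in>?U. Poly_Mapping.lookup (u + v) i)"
    by (rule mon_degree_superset) (auto simp: keys_add_mon)
  also have "\<dots> = mon_degree u + mon_degree v"
    by (simp add: lookup_add sum.distrib mon_degree_superset[of ?U u] mon_degree_superset[of ?U v])
  finally show ?thesis .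
qed

lemma mon_degree_eq_0_iff: "mon_degree u = 0 \<longleftrightarrow> u = 0"
  by (auto simp: mon_degree_def in_keys_iff poly_mapping_eq_iff fun_eq_iff)

lemma mon_dvd_degree_less: "mon_dvd v u \<Longrightarrow> v \<noteq> u \<Longrightarrow> mon_degree v < mon_degree u"
  by (auto simp: mon_dvd_def mon_degree_add mon_degree_eq_0_iff intro!: Nat.gr0I)

section \<open>Monomial ideals\<close>

lemma mon_poly_times_single: "mon_poly w * Poly_Mapping.single u c = Poly_Mapping.single (w + u) c"
  by (simp add: mon_poly_def mult_single)

lemma mon_poly_in_carrier: "u \<in> monomials n \<Longrightarrow> (mon_poly u :: 'k::field mpoly) \<in> carrier (mpoly_ring n)"
  by (simp add: mon_poly_def)

lemma ring_mpoly_ring: "ring (mpoly_ring n :: 'k::field mpoly ring)"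
  by (rule cring.axioms(1)[OF cring_mpoly_ring])

text \<open>
  The monomial ideal generated by \<open>G\<close>, described through divisibility, so that membership
  can be tested term by term.
\<close>

definition monomial_span :: "nat \<Rightarrow> mon set \<Rightarrow> 'k::field mpoly set" where
  "monomial_span n G =
     {p. Poly_Mapping.keys p \<subseteq> monomials n \<and> (\<forall>u\<in>Poly_Mapping.keys p. \<exists>g\<in>G. mon_dvd g u)}"

lemma monomial_span_ideal: "ideal (monomial_span n G :: 'k::field mpoly set) (mpoly_ring n)"
proof (rule idealI[OF ring_mpoly_ring])
  interpret R: ring "mpoly_ring n :: 'k mpoly ring" by (rule ring_mpoly_ring)
  show "subgroup (monomial_span n G :: 'k mpoly set) (add_monoid (mpoly_ring n))"
  proof (rule R.add.subgroupI)
    fix p :: "'k mpoly" assume p: "p \<in> monomial_span n G"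
    then have "\<ominus>\<^bsub>mpoly_ring n\<^esub> p = - p"
      by (intro R.minus_equality) (auto simp: monomial_span_def)
    with p show "\<ominus>\<^bsub>mpoly_ring n\<^esub> p \<in> monomial_span n G"
      by (simp add: monomial_span_def)
  next
    fix p q :: "'k mpoly" assume pq: "p \<in> monomial_span n G" "q \<in> monomial_span n G"
    have "p + q \<in> monomial_span n G"
      using Poly_Mapping.keys_add[of p q] pq by (auto simp: monomial_span_def)
    then show "p \<oplus>\<^bsub>mpoly_ring n\<^esub> q \<in> monomial_span n G"
      by simp
  next
    have "(0 :: 'k mpoly) \<in> monomial_span n G" by (simp add: monomial_span_def)
    then show "(monomial_span n G :: 'k mpoly set) \<noteq> {}" by blast
  qed (auto simp: monomial_span_def)
  have mult: "q * p \<in> monomial_span n G"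
    if "p \<in> monomial_span n G" "Poly_Mapping.keys q \<subseteq> monomials n" for p q :: "'k mpoly"
  proof -
    have "\<exists>g\<in>G. mon_dvd g u" if u: "u \<in> Poly_Mapping.keys (q * p)" for u
    proof -
      obtain v w where vw: "u = v + w" "w \<in> Poly_Mapping.keys p"
        using keys_mult[of q p] u by auto
      then obtain g where "g \<in> G" "mon_dvd g w"
        using \<open>p \<in> monomial_span n G\<close> by (auto simp: monomial_span_def)
      moreover have "mon_dvd w u" using vw by (auto simp: mon_dvd_def add.commute)
      ultimately show ?thesis using mon_dvd_trans by blast
    qed
    then show ?thesis
      using mpoly_mult_closed[of q n p] that by (simp add: monomial_span_def)
  qed
  fix p q :: "'k mpoly" assume "p \<in> monomial_span n G" "q \<in> carrier (mpoly_ring n)"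
  then show "q \<otimes>\<^bsub>mpoly_ring n\<^esub> p \<in> monomial_span n G"
    and "p \<otimes>\<^bsub>mpoly_ring n\<^esub> q \<in> monomial_span n G"
    using mult[of p q] by (simp_all add: mult.commute)
qed

lemma ideal_sum_closed:
  assumes "ideal J (mpoly_ring n :: 'k::field mpoly ring)" "\<And>x. x \<in> A \<Longrightarrow> h x \<in> J"
  shows "sum h A \<in> J"
proof -
  interpret ideal J "mpoly_ring n :: 'k mpoly ring" by fact
  show ?thesis
    using assms(2)
  proof (induction A rule: infinite_finite_induct)
    case (insert x A)
    then show ?case
      using additive_subgroup.a_closed[OF ideal.axioms(1)[OF assms(1)], of "h x" "sum h A"] by simp
  qed (use additive_subgroup.zero_closed[OF ideal.axioms(1)[OF assms(1)]] in simp_all)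
qed

lemma ideal_mon_mult_closed:
  assumes "ideal J (mpoly_ring n :: 'k::field mpoly ring)" "f \<in> J" "w \<in> monomials n"
  shows "mon_poly w * f \<in> J"
  using ideal.I_l_closed[OF assms(1,2), of "mon_poly w"] mon_poly_in_carrier[OF assms(3)] by simp

text \<open>
  A polynomial all of whose terms are divisible by elements of \<open>G\<close> is a sum of multiples of
  these elements; conversely the polynomials of this kind form an ideal, which contains \<open>G\<close>.
\<close>

lemma genideal_monomials:
  assumes G: "G \<subseteq> monomials n"
  shows "Idl\<^bsub>mpoly_ring n\<^esub> (mon_poly ` G) = (monomial_span n G :: 'k::field mpoly set)"
proof
  interpret R: ring "mpoly_ring n :: 'k mpoly ring" by (rule ring_mpoly_ring)
  show "Idl\<^bsub>mpoly_ring n\<^esub> (mon_poly ` G) \<subseteq> (monomial_span n G :: 'k mpoly set)"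
    by (rule R.genideal_minimal[OF monomial_span_ideal])
      (use G mon_dvd_refl in \<open>fastforce simp: monomial_span_def mon_poly_def\<close>)
  have GC: "(mon_poly ` G :: 'k mpoly set) \<subseteq> carrier (mpoly_ring n)"
    using G by (auto simp: mon_poly_def)
  note id = R.genideal_ideal[OF GC]
  show "(monomial_span n G :: 'k mpoly set) \<subseteq> Idl\<^bsub>mpoly_ring n\<^esub> (mon_poly ` G)"
  proof
    fix p :: "'k mpoly" assume p: "p \<in> monomial_span n G"
    have "Poly_Mapping.single u (Poly_Mapping.lookup p u) \<in> Idl\<^bsub>mpoly_ring n\<^esub> (mon_poly ` G)"
      if u: "u \<in> Poly_Mapping.keys p" for u
    proof -
      obtain g w where g: "g \<in> G" "u = g + w"
        using p u by (auto simp: monomial_span_def mon_dvd_def)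
      have "u \<in> monomials n" using p u by (auto simp: monomial_span_def)
      then have "w \<in> monomials n" using g by (simp add: add_in_monomials_iff)
      then have w: "Poly_Mapping.single w (Poly_Mapping.lookup p u) \<in> carrier (mpoly_ring n)"
        by auto
      have "mon_poly g \<in> Idl\<^bsub>mpoly_ring n\<^esub> (mon_poly ` G :: 'k mpoly set)"
        using R.genideal_self[OF GC] g by blast
      from ideal.I_r_closed[OF id this w] g(2) show ?thesis
        by (simp add: mon_poly_times_single)
    qed
    then show "p \<in> Idl\<^bsub>mpoly_ring n\<^esub> (mon_poly ` G)"
      by (subst poly_mapping_sum_single[of p]) (rule ideal_sum_closed[OF id])
  qed
qed

lemma mon_poly_in_monomial_span:
  "(mon_poly u :: 'k::field mpoly) \<in> monomial_span n G \<longleftrightarrow> u \<in> monomials n \<and> (\<exists>g\<in>G. mon_dvd g u)"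
  by (simp add: monomial_span_def mon_poly_def)

lemma monomial_span_mono:
  assumes "\<And>g. g \<in> G \<Longrightarrow> \<exists>h\<in>G'. mon_dvd h g"
  shows "monomial_span n G \<subseteq> monomial_span n G'"
  unfolding monomial_span_def using assms mon_dvd_trans by blast

section \<open>Leading monomials of an ideal\<close>

text \<open>
  The relational form of \<open>lead_mon\<close>: unlike that total function, it fails for the zero polynomial,
  so that \<open>lead_monomials\<close> only collects monomials of nonzero elements.
\<close>

definition is_lead_mon :: "mon rel \<Rightarrow> 'k::field mpoly \<Rightarrow> mon \<Rightarrow> bool" where
  "is_lead_mon ord f u \<longleftrightarrow>
     u \<in> Poly_Mapping.keys f \<and> (\<forall>v\<in>Poly_Mapping.keys f. (v, u) \<in> ord)"

definition lead_monomials :: "mon rel \<Rightarrow> 'k::field mpoly set \<Rightarrow> mon set" where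
  "lead_monomials ord J = {u. \<exists>f\<in>J. is_lead_mon ord f u}"

lemma term_orderD:
  assumes "term_order n ord"
  shows term_order_refl: "u \<in> monomials n \<Longrightarrow> (u, u) \<in> ord"
    and term_order_trans: "(u, v) \<in> ord \<Longrightarrow> (v, w) \<in> ord \<Longrightarrow> (u, w) \<in> ord"
    and term_order_antisym: "(u, v) \<in> ord \<Longrightarrow> (v, u) \<in> ord \<Longrightarrow> u = v"
    and term_order_total: "u \<in> monomials n \<Longrightarrow> v \<in> monomials n \<Longrightarrow> (u, v) \<in> ord \<or> (v, u) \<in> ord"
    and term_order_zero: "u \<in> monomials n \<Longrightarrow> (0, u) \<in> ord"
    and term_order_add: "(u, v) \<in> ord \<Longrightarrow> w \<in> monomials n \<Longrightarrow> (u + w, v + w) \<in> ord"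
proof -
  have lin: "refl_on (monomials n) ord" "trans ord" "antisym ord" "total_on (monomials n) ord"
    and sub: "ord \<subseteq> monomials n \<times> monomials n"
    using assms by (auto simp: term_order_def order_on_defs)
  show refl: "(u, u) \<in> ord" if "u \<in> monomials n" for u
    using lin(1) that by (simp add: refl_on_def)
  show "(u, v) \<in> ord \<Longrightarrow> (v, w) \<in> ord \<Longrightarrow> (u, w) \<in> ord"
    by (rule transD[OF lin(2)])
  show "(u, v) \<in> ord \<Longrightarrow> (v, u) \<in> ord \<Longrightarrow> u = v"
    by (rule antisymD[OF lin(3)])
  show "u \<in> monomials n \<Longrightarrow> v \<in> monomials n \<Longrightarrow> (u, v) \<in> ord \<or> (v, u) \<in> ord"
    using lin(4) refl unfolding total_on_def by metis
  show "u \<in> monomials n \<Longrightarrow> (0, u) \<in> ord"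
    using assms by (simp add: term_order_def)
  show "(u, v) \<in> ord \<Longrightarrow> w \<in> monomials n \<Longrightarrow> (u + w, v + w) \<in> ord"
    using assms sub by (auto simp: term_order_def)
qed

lemma term_order_finite_max:
  assumes "term_order n ord" "finite U" "U \<noteq> {}" "U \<subseteq> monomials n"
  shows "\<exists>u\<in>U. \<forall>v\<in>U. (v, u) \<in> ord"
  using assms(2-4)
proof (induction U rule: finite_ne_induct)
  case (singleton x)
  then show ?case using term_order_refl[OF assms(1)] by simp
next
  case (insert x U)
  then obtain u where u: "u \<in> U" "\<forall>v\<in>U. (v, u) \<in> ord" by auto
  have "x \<in> monomials n" "u \<in> monomials n" using insert.prems u by auto
  then consider "(x, u) \<in> ord" | "(u, x) \<in> ord" "(x, x) \<in> ord"
    using term_order_total[OF assms(1)] term_order_refl[OF assms(1)] by blast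
  then show ?case
  proof cases
    case 1
    then show ?thesis using u by blast
  next
    case 2
    then have "\<forall>v\<in>insert x U. (v, x) \<in> ord"
      using u(2) term_order_trans[OF assms(1)] by blast
    then show ?thesis by blast
  qed
qed

lemma initial_form_eq:
  assumes "term_order n ord" "is_lead_mon ord f u"
  shows "initial_form ord f = mon_poly u"
proof -
  have "lead_mon ord f = u"
    unfolding lead_mon_def
    by (rule the_equality)
      (use assms(2) term_order_antisym[OF assms(1)] in \<open>auto simp: is_lead_mon_def\<close>)
  moreover have "f \<noteq> 0" using assms(2) by (auto simp: is_lead_mon_def)
  ultimately show ?thesis by (simp add: initial_form_def)
qed

lemma is_lead_mon_exists:
  assumes "term_order n ord" "Poly_Mapping.keys f \<subseteq> monomials n" "f \<noteq> 0"
  shows "\<exists>u. is_lead_mon ord f u"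
  using term_order_finite_max[OF assms(1) _ _ assms(2)] assms(3)
  by (auto simp: is_lead_mon_def)

lemma ideal_subset_mpoly: "ideal J (mpoly_ring n) \<Longrightarrow> f \<in> J \<Longrightarrow> Poly_Mapping.keys f \<subseteq> monomials n"
  using additive_subgroup.a_Hcarr[OF ideal.axioms(1), of J "mpoly_ring n" f] by simp

lemma lead_monomials_subset:
  assumes "ideal J (mpoly_ring n)"
  shows "lead_monomials ord J \<subseteq> monomials n"
  using ideal_subset_mpoly[OF assms] by (auto simp: lead_monomials_def is_lead_mon_def)

text \<open>
  The initial form of the zero polynomial is \<open>0\<close>, which is no monomial, but which adds nothing to the
  generated ideal. All other initial forms are leading monomials.
\<close>

lemma initial_ideal_eq:
  assumes ord: "term_order n ord" and J: "ideal J (mpoly_ring n :: 'k::field mpoly ring)"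
  shows "initial_ideal n ord J = monomial_span n (lead_monomials ord J)"
proof -
  let ?M = "mon_poly ` lead_monomials ord J :: 'k mpoly set"
  let ?T = "{initial_form ord f | f. f \<in> J}"
  interpret R: ring "mpoly_ring n :: 'k mpoly ring" by (rule ring_mpoly_ring)
  have M: "?M \<subseteq> ?T"
  proof
    fix p :: "'k mpoly" assume "p \<in> ?M"
    then obtain f u where "p = mon_poly u" "f \<in> J" "is_lead_mon ord f u"
      by (auto simp: lead_monomials_def)
    then show "p \<in> ?T"
      using initial_form_eq[OF ord] by force
  qed
  have T: "?T \<subseteq> insert 0 ?M"
  proof safe
    fix f assume f: "f \<in> J" and nz: "initial_form ord f \<notin> ?M"
    show "initial_form ord f = 0"
    proof (cases "f = 0")
      case False
      then obtain u where "is_lead_mon ord f u"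
        using is_lead_mon_exists[OF ord ideal_subset_mpoly[OF J f]] by blast
      then show ?thesis using nz initial_form_eq[OF ord, of f u] f by (auto simp: lead_monomials_def)
    qed (simp add: initial_form_def)
  qed
  have MC: "?M \<subseteq> carrier (mpoly_ring n)"
    using lead_monomials_subset[OF J, of ord] by (auto simp: mon_poly_def)
  with T have TC: "?T \<subseteq> carrier (mpoly_ring n)" by fastforce
  have "Idl\<^bsub>mpoly_ring n\<^esub> ?T = Idl\<^bsub>mpoly_ring n\<^esub> ?M"
  proof
    have "0 \<in> Idl\<^bsub>mpoly_ring n\<^esub> ?M"
      using additive_subgroup.zero_closed[OF ideal.axioms(1)[OF R.genideal_ideal[OF MC]]] by simp
    with R.genideal_self[OF MC] have "insert 0 ?M \<subseteq> Idl\<^bsub>mpoly_ring n\<^esub> ?M"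
      by (simp only: insert_subset)
    then show "Idl\<^bsub>mpoly_ring n\<^esub> ?T \<subseteq> Idl\<^bsub>mpoly_ring n\<^esub> ?M"
      by (rule R.genideal_minimal[OF R.genideal_ideal[OF MC] subset_trans[OF T]])
    show "Idl\<^bsub>mpoly_ring n\<^esub> ?M \<subseteq> Idl\<^bsub>mpoly_ring n\<^esub> ?T"
      by (rule R.genideal_minimal[OF R.genideal_ideal[OF TC] subset_trans[OF M R.genideal_self[OF TC]]])
  qed
  then show ?thesis
    unfolding initial_ideal_def by (simp only: genideal_monomials[OF lead_monomials_subset[OF J]])
qed

lemma lookup_mon_poly_times:
  "Poly_Mapping.lookup (mon_poly w * f :: 'k::field mpoly) (w + u) = Poly_Mapping.lookup f u"
proof -
  have "mon_poly w * f =
      (\<Sum>v\<in>Poly_Mapping.keys f. Poly_Mapping.single (w + v) (Poly_Mapping.lookup f v))"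
    using arg_cong[OF poly_mapping_sum_single[of f], of "(*) (mon_poly w)"]
    by (simp only: sum_distrib_left mon_poly_times_single)
  then show ?thesis
    by (simp add: lookup_sum lookup_single when_def in_keys_iff)
qed

lemma lead_monomials_add:
  assumes ord: "term_order n ord" and J: "ideal J (mpoly_ring n :: 'k::field mpoly ring)"
    and u: "u \<in> lead_monomials ord J" and w: "w \<in> monomials n"
  shows "u + w \<in> lead_monomials ord J"
proof -
  obtain f where f: "f \<in> J" "is_lead_mon ord f u"
    using u by (auto simp: lead_monomials_def)
  have "is_lead_mon ord (mon_poly w * f) (u + w)"
    unfolding is_lead_mon_def
  proof (intro conjI ballI)
    show "u + w \<in> Poly_Mapping.keys (mon_poly w * f)"
      using f(2) lookup_mon_poly_times[of w f u]
      by (simp add: is_lead_mon_def in_keys_iff add.commute)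
    fix v assume "v \<in> Poly_Mapping.keys (mon_poly w * f)"
    then obtain v' where "v = v' + w" "v' \<in> Poly_Mapping.keys f"
      using keys_mult[of "mon_poly w" f] by (auto simp: mon_poly_def add.commute)
    then show "(v, u + w) \<in> ord"
      using f(2) term_order_add[OF ord _ w] by (simp add: is_lead_mon_def)
  qed
  with ideal_mon_mult_closed[OF J f(1) w] show ?thesis
    by (auto simp: lead_monomials_def)
qed

lemma lead_monomials_dvd:
  assumes "term_order n ord" "ideal J (mpoly_ring n :: 'k::field mpoly ring)"
    and "u \<in> lead_monomials ord J" "mon_dvd u v" "v \<in> monomials n"
  shows "v \<in> lead_monomials ord J"
  using assms lead_monomials_add[OF assms(1-3)] by (auto simp: mon_dvd_def add_in_monomials_iff)

text \<open>
  The set \<open>L\<close> of leading monomials is closed under multiples, so a monomial lies in the initial ideal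
  only if it lies in \<open>L\<close>. Therefore the minimal generators are the elements of \<open>L\<close> that are minimal
  for divisibility, and every element of \<open>L\<close> lies above one of these because degrees decrease. The
  only divisor in \<open>L\<close> of a minimal element is that element itself, which is why the right-hand side
  forces it to satisfy \<open>P\<close>. This form of the condition speaks of no generators and can be checked
  for one leading monomial at a time.
\<close>

lemma minimal_generators_initial_ideal_iff:
  assumes ord: "term_order n ord" and J: "ideal J (mpoly_ring n :: 'k::field mpoly ring)"
  shows "(\<exists>G. minimal_monomial_generators n (initial_ideal n ord J) G \<and> (\<forall>u\<in>G. P u)) \<longleftrightarrow>
    (\<forall>u\<in>lead_monomials ord J. \<exists>u'\<in>lead_monomials ord J. mon_dvd u' u \<and> P u')"
    (is "?L \<longleftrightarrow> ?R")
proof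
  let ?LM = "lead_monomials ord J"
  note LM = lead_monomials_subset[OF J, of ord]
  have gen: "generated_by_monomials n (initial_ideal n ord J) G \<longleftrightarrow>
      G \<subseteq> monomials n \<and> monomial_span n G = (monomial_span n ?LM :: 'k mpoly set)" for G
    using genideal_monomials[of G n, where 'k = 'k]
    by (auto simp: generated_by_monomials_def initial_ideal_eq[OF ord J])
  {
    assume ?L
    then obtain G where G: "G \<subseteq> monomials n" "\<forall>u\<in>G. P u"
      and span: "monomial_span n G = (monomial_span n ?LM :: 'k mpoly set)"
      by (auto simp: minimal_monomial_generators_def gen)
    show ?R
    proof
      fix u assume u: "u \<in> ?LM"
      then have "(mon_poly u :: 'k mpoly) \<in> monomial_span n ?LM"
        using LM mon_dvd_refl by (auto simp: mon_poly_in_monomial_span)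
      then obtain g where g: "g \<in> G" "mon_dvd g u"
        by (auto simp: span[symmetric] mon_poly_in_monomial_span)
      have "(mon_poly g :: 'k mpoly) \<in> monomial_span n G"
        using G g mon_dvd_refl by (auto simp: mon_poly_in_monomial_span)
      then have "g \<in> ?LM"
        using lead_monomials_dvd[OF ord J] by (auto simp: span mon_poly_in_monomial_span)
      with g G show "\<exists>u'\<in>?LM. mon_dvd u' u \<and> P u'" by blast
    qed
  next
    assume R: ?R
    define G where "G = {u \<in> ?LM. \<forall>v\<in>?LM. mon_dvd v u \<longrightarrow> v = u}"
    have below: "\<exists>g\<in>G. mon_dvd g u" if "u \<in> ?LM" for u
      using that
    proof (induction "mon_degree u" arbitrary: u rule: less_induct)
      case less
      show ?case
      proof (cases "u \<in> G")
        case False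
        then obtain v where v: "v \<in> ?LM" "mon_dvd v u" "v \<noteq> u"
          using less.prems by (auto simp: G_def)
        with less.hyps[OF mon_dvd_degree_less] show ?thesis
          using mon_dvd_trans by blast
      qed (use mon_dvd_refl in blast)
    qed
    have span: "monomial_span n G = (monomial_span n ?LM :: 'k mpoly set)"
    proof
      show "monomial_span n G \<subseteq> (monomial_span n ?LM :: 'k mpoly set)"
        by (rule monomial_span_mono) (use mon_dvd_refl in \<open>auto simp: G_def\<close>)
      show "monomial_span n ?LM \<subseteq> (monomial_span n G :: 'k mpoly set)"
        by (rule monomial_span_mono) (rule below)
    qed
    have "\<not> generated_by_monomials n (initial_ideal n ord J) G'" if less: "G' \<subset> G" for G'
    proof
      assume "generated_by_monomials n (initial_ideal n ord J) G'"
      then have span': "monomial_span n G' = (monomial_span n G :: 'k mpoly set)"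
        by (simp add: gen span)
      obtain g where g: "g \<in> G" "g \<notin> G'" using less by blast
      have "g \<in> monomials n" using g LM by (auto simp: G_def)
      then have "(mon_poly g :: 'k mpoly) \<in> monomial_span n G"
        using g mon_dvd_refl by (auto simp: mon_poly_in_monomial_span)
      then obtain g' where "g' \<in> G'" "mon_dvd g' g"
        by (auto simp: span'[symmetric] mon_poly_in_monomial_span)
      with g less show False by (auto simp: G_def)
    qed
    moreover have "generated_by_monomials n (initial_ideal n ord J) G"
      using LM by (simp only: gen span) (auto simp: G_def)
    moreover have "\<forall>u\<in>G. P u" using R by (auto simp: G_def)
    ultimately show ?L unfolding minimal_monomial_generators_def by blast
  }
qed

section \<open>The toric homomorphism on monomials\<close>

text \<open>
  The factor \<open>of_nat k\<close> acts by \<open>k\<close>-fold addition, since exponents with their convolution product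
  form a semiring; \<open>lookup_of_nat_times\<close> below is the coordinatewise form.
\<close>

definition toric_exponent :: "(nat \<Rightarrow> nat vec) \<Rightarrow> mon \<Rightarrow> mon" where
  "toric_exponent a u =
     (\<Sum>j\<in>Poly_Mapping.keys u. of_nat (Poly_Mapping.lookup u j) * mon_of_vec (a j))"

lemma toric_exponent_superset:
  assumes "finite U" "Poly_Mapping.keys u \<subseteq> U"
  shows "toric_exponent a u = (\<Sum>j\<in>U. of_nat (Poly_Mapping.lookup u j) * mon_of_vec (a j))"
  unfolding toric_exponent_def
  by (rule sum.mono_neutral_left) (use assms in \<open>auto simp: in_keys_iff\<close>)

lemma toric_exponent_zero: "toric_exponent a 0 = 0"
  by (simp add: toric_exponent_def)

lemma toric_exponent_var: "toric_exponent a (Poly_Mapping.single j 1) = mon_of_vec (a j)"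
  by (simp add: toric_exponent_def)

lemma toric_exponent_add: "toric_exponent a (u + v) = toric_exponent a u + toric_exponent a v"
proof -
  let ?U = "Poly_Mapping.keys u \<union> Poly_Mapping.keys v"
  have "toric_exponent a (u + v) =
      (\<Sum>j\<in>?U. of_nat (Poly_Mapping.lookup (u + v) j) * mon_of_vec (a j))"
    by (rule toric_exponent_superset) (auto simp: keys_add_mon)
  also have "\<dots> = toric_exponent a u + toric_exponent a v"
    by (simp add: lookup_add sum.distrib distrib_right
        toric_exponent_superset[of ?U u] toric_exponent_superset[of ?U v])
  finally show ?thesis .
qed

lemma lookup_of_nat_times: "Poly_Mapping.lookup (of_nat k * b :: mon) i = k * Poly_Mapping.lookup b i"
  by (induction k) (simp_all add: lookup_add distrib_right)

lemma lookup_toric_exponent: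
  "Poly_Mapping.lookup (toric_exponent a u) i =
     (\<Sum>j\<in>Poly_Mapping.keys u. Poly_Mapping.lookup u j * Poly_Mapping.lookup (mon_of_vec (a j)) i)"
  by (simp add: toric_exponent_def lookup_sum lookup_of_nat_times)

lemma mon_poly_mult: "mon_poly u * mon_poly v = mon_poly (u + v)"
  by (simp add: mon_poly_def mult_single)

lemma mon_poly_power: "mon_poly b ^ k = mon_poly (of_nat k * b)"
  by (induction k) (simp_all add: mon_poly_mult distrib_right, simp add: mon_poly_def)

lemma mon_poly_prod: "(\<Prod>j\<in>A. mon_poly (h j)) = mon_poly (sum h A)"
  by (induction A rule: infinite_finite_induct) (simp_all add: mon_poly_mult, simp_all add: mon_poly_def)

lemma toric_hom_single:
  "toric_hom a (Poly_Mapping.single u c) = Poly_Mapping.single (toric_exponent a u) c"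
  unfolding toric_hom_def poly_subst_single mon_poly_power mon_poly_prod
  by (simp add: toric_exponent_def const_poly_def mon_poly_def mult_single)

lemma toric_hom_sum: "toric_hom a (sum h A) = (\<Sum>x\<in>A. toric_hom a (h x))"
  by (simp add: toric_hom_def poly_subst_sum)

lemma toric_hom_eq:
  "toric_hom a f =
     (\<Sum>u\<in>Poly_Mapping.keys f. Poly_Mapping.single (toric_exponent a u) (Poly_Mapping.lookup f u))"
  using arg_cong[OF poly_mapping_sum_single[of f], of "toric_hom a"]
  by (simp only: toric_hom_sum toric_hom_single)

lemma lookup_toric_hom:
  "Poly_Mapping.lookup (toric_hom a f) w =
     (\<Sum>u\<in>{u \<in> Poly_Mapping.keys f. toric_exponent a u = w}. Poly_Mapping.lookup f u)"
  by (simp add: toric_hom_eq lookup_sum lookup_single when_def sum.inter_filter)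

lemma keys_toric_hom: "Poly_Mapping.keys (toric_hom a f) \<subseteq> toric_exponent a ` Poly_Mapping.keys f"
proof
  fix w assume "w \<in> Poly_Mapping.keys (toric_hom a f)"
  then have "{u \<in> Poly_Mapping.keys f. toric_exponent a u = w} \<noteq> {}"
    unfolding in_keys_iff lookup_toric_hom by (metis sum.empty)
  then show "w \<in> toric_exponent a ` Poly_Mapping.keys f" by blast
qed

lemma toric_exponent_in_monomials:
  assumes "a ` {..<r} \<subseteq> carrier_vec s" "u \<in> monomials r"
  shows "toric_exponent a u \<in> monomials s"
proof -
  have "i < s" if i: "i \<in> Poly_Mapping.keys (toric_exponent a u)" for i
  proof -
    obtain j where "j \<in> Poly_Mapping.keys u" "Poly_Mapping.lookup (mon_of_vec (a j)) i \<noteq> 0"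
      using i unfolding in_keys_iff[of i] lookup_toric_exponent
      by (elim sum.not_neutral_contains_not_neutral) auto
    moreover have "a j \<in> carrier_vec s" using calculation assms by (auto simp: monomials_def)
    ultimately show ?thesis by (auto simp: lookup_mon_of_vec split: if_splits)
  qed
  then show ?thesis by (auto simp: monomials_def)
qed

lemma toric_preimage_ideal:
  assumes "a ` {..<r} \<subseteq> carrier_vec s" "ideal I (mpoly_ring s :: 'k::field mpoly ring)"
  shows "ideal (toric_preimage r a I) (mpoly_ring r)"
proof -
  interpret ring_hom_ring "mpoly_ring r :: 'k mpoly ring" "mpoly_ring s" "toric_hom a"
    by (rule ring_hom_ringI2[OF ring_mpoly_ring ring_mpoly_ring toric_hom_ring_hom[OF assms(1)]])
  show ?thesis
    unfolding toric_preimage_def by (rule ideal_vimage[OF assms(2)])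
qed

lemma toric_ideal_eq_preimage: "toric_ideal r s a = toric_preimage r a {0}"
  by (simp add: toric_ideal_def toric_preimage_def a_kernel_def')

lemma toric_ideal_ideal:
  assumes "a ` {..<r} \<subseteq> carrier_vec s"
  shows "ideal (toric_ideal r s a :: 'k::field mpoly set) (mpoly_ring r)"
  using toric_preimage_ideal[OF assms ring.zeroideal[OF ring_mpoly_ring[of s, where 'k = 'k]]]
  by (simp add: toric_ideal_eq_preimage)

section \<open>Homogeneous parts\<close>

definition restrict_poly :: "mon set \<Rightarrow> 'k::field mpoly \<Rightarrow> 'k mpoly" where
  "restrict_poly A f =
     (\<Sum>u\<in>{u \<in> Poly_Mapping.keys f. u \<in> A}. Poly_Mapping.single u (Poly_Mapping.lookup f u))"

lemma lookup_restrict_poly: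
  "Poly_Mapping.lookup (restrict_poly A f) u = (if u \<in> A then Poly_Mapping.lookup f u else 0)"
  by (auto simp: restrict_poly_def lookup_sum lookup_single when_def in_keys_iff)

lemma keys_restrict_poly: "Poly_Mapping.keys (restrict_poly A f) = Poly_Mapping.keys f \<inter> A"
  by (auto simp: in_keys_iff lookup_restrict_poly split: if_splits)

lemma homogeneous_component_eq:
  "homogeneous_component V h f = restrict_poly {u. multidegree V u = h} f"
  by (simp add: homogeneous_component_def restrict_poly_def)

text \<open>
  The terms of \<open>f\<close> whose exponent maps to \<open>w\<close> account for the whole coefficient of \<open>\<phi>(f)\<close> at \<open>w\<close>.
\<close>

lemma toric_hom_restrict_fibre:
  "toric_hom a (restrict_poly {u. toric_exponent a u = w} f) =
     Poly_Mapping.single w (Poly_Mapping.lookup (toric_hom a f) w)"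
proof (rule poly_mapping_eqI)
  fix x
  have "{u \<in> Poly_Mapping.keys f \<inter> {u. toric_exponent a u = w}. toric_exponent a u = x} =
      (if x = w then {u \<in> Poly_Mapping.keys f. toric_exponent a u = w} else {})"
    by auto
  then show "Poly_Mapping.lookup (toric_hom a (restrict_poly {u. toric_exponent a u = w} f)) x =
      Poly_Mapping.lookup (Poly_Mapping.single w (Poly_Mapping.lookup (toric_hom a f) w)) x"
    by (auto simp: lookup_toric_hom keys_restrict_poly lookup_restrict_poly lookup_single when_def
        intro: sum.cong)
qed

section \<open>The image of the toric homomorphism\<close>

lemma mon_of_vec_of_mon: "w \<in> monomials s \<Longrightarrow> mon_of_vec (vec_of_mon s w) = w"
  by (rule poly_mapping_eqI) (auto simp: lookup_mon_of_vec vec_of_mon_def monomials_def in_keys_iff)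

lemma vec_of_mon_of_vec: "b \<in> carrier_vec s \<Longrightarrow> vec_of_mon s (mon_of_vec b) = b"
  by (rule eq_vecI) (auto simp: lookup_mon_of_vec vec_of_mon_def)

text \<open>
  Injectivity of \<open>a\<close> turns the sum over the set of generators into a sum over their indices.
\<close>

lemma mon_of_vec_lincomb:
  fixes a :: "nat \<Rightarrow> nat vec"
  assumes a: "a ` {..<r} \<subseteq> carrier_vec s" and inj: "inj_on a {..<r}"
  shows "mon_of_vec (finsum_vec TYPE(nat) s (\<lambda>g. of_nat (c g) \<cdot>\<^sub>v g) (a ` {..<r})) =
    (\<Sum>j<r. of_nat (c (a j)) * mon_of_vec (a j))"
    (is "mon_of_vec ?b = _")
proof (rule poly_mapping_eqI)
  fix i
  have dim: "dim_vec (a j) = s" if "j < r" for j using a that by auto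
  have Pi: "(\<lambda>g. of_nat (c g) \<cdot>\<^sub>v g) \<in> a ` {..<r} \<rightarrow> carrier_vec s"
    using a by auto
  have b: "dim_vec ?b = s"
    using finsum_vec_closed[OF Pi] by simp
  have "Poly_Mapping.lookup (mon_of_vec ?b) i = (if i < s then ?b $ i else 0)"
    by (simp only: lookup_mon_of_vec b)
  also have "\<dots> = (if i < s then \<Sum>j<r. c (a j) * a j $ i else 0)"
  proof (cases "i < s")
    case True
    then have "?b $ i = (\<Sum>g\<in>a ` {..<r}. (of_nat (c g) \<cdot>\<^sub>v g) $ i)"
      by (intro index_finsum_vec[OF _ _ Pi]) simp_all
    also have "\<dots> = (\<Sum>j<r. c (a j) * a j $ i)"
      using True dim by (simp add: sum.reindex[OF inj])
    finally show ?thesis by simp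
  qed simp
  also have "\<dots> = Poly_Mapping.lookup (\<Sum>j<r. of_nat (c (a j)) * mon_of_vec (a j)) i"
    using dim by (auto simp: lookup_sum lookup_of_nat_times lookup_mon_of_vec)
  finally show "Poly_Mapping.lookup (mon_of_vec ?b) i =
    Poly_Mapping.lookup (\<Sum>j<r. of_nat (c (a j)) * mon_of_vec (a j)) i" .
qed

lemma semigroup_generated_monomials:
  assumes a: "a ` {..<r} \<subseteq> carrier_vec s" and inj: "inj_on a {..<r}"
  shows "mon_of_vec ` semigroup_generated s (a ` {..<r}) = toric_exponent a ` monomials r"
proof safe
  fix b assume "b \<in> semigroup_generated s (a ` {..<r})"
  then obtain c :: "nat vec \<Rightarrow> nat" where
    b: "b = finsum_vec TYPE(nat) s (\<lambda>g. of_nat (c g) \<cdot>\<^sub>v g) (a ` {..<r})"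
    by (auto simp: semigroup_generated_def)
  define u :: mon where "u = (\<Sum>j<r. Poly_Mapping.single j (c (a j)))"
  have lu: "Poly_Mapping.lookup u j = (if j < r then c (a j) else 0)" for j
    by (auto simp: u_def lookup_sum lookup_single when_def)
  then have ku: "Poly_Mapping.keys u \<subseteq> {..<r}" by (auto simp: in_keys_iff split: if_splits)
  then have "mon_of_vec b = toric_exponent a u"
    by (simp only: b mon_of_vec_lincomb[OF a inj]) (simp add: toric_exponent_superset[OF _ ku] lu)
  with ku show "mon_of_vec b \<in> toric_exponent a ` monomials r" by (auto simp: monomials_def)
next
  fix u assume "u \<in> monomials r"
  then have ku: "Poly_Mapping.keys u \<subseteq> {..<r}" by (simp add: monomials_def)
  \<comment> \<open>The coefficients of the exponent \<open>u\<close>, indexed by the generators instead of their indices.\<close>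
  define c where "c g = Poly_Mapping.lookup u (inv_into {..<r} a g)" for g
  have "toric_exponent a u = (\<Sum>j<r. of_nat (c (a j)) * mon_of_vec (a j))"
    by (subst toric_exponent_superset[OF _ ku]) (simp_all add: c_def inv_into_f_f[OF inj])
  then have "toric_exponent a u =
      mon_of_vec (finsum_vec TYPE(nat) s (\<lambda>g. of_nat (c g) \<cdot>\<^sub>v g) (a ` {..<r}))"
    by (simp only: mon_of_vec_lincomb[OF a inj])
  then show "toric_exponent a u \<in> mon_of_vec ` semigroup_generated s (a ` {..<r})"
    unfolding semigroup_generated_def by blast
qed

text \<open>
  Whether a monomial of \<open>S\<close> is the image of a monomial of \<open>R\<close> depends only on its degree. This is
  what the hypothesis on the generators is used for.
\<close>

lemma toric_exponent_image_iff:
  assumes V: "V \<in> carrier_mat d s" and a: "a ` {..<r} \<subseteq> carrier_vec s" and inj: "inj_on a {..<r}"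
    and gen: "semigroup_generated s (a ` {..<r}) = {b \<in> carrier_vec s. V *\<^sub>v map_vec int b \<in> H}"
    and w: "w \<in> monomials s"
  shows "w \<in> toric_exponent a ` monomials r \<longleftrightarrow> multidegree V w \<in> H"
proof -
  have "w \<in> mon_of_vec ` {b \<in> carrier_vec s. V *\<^sub>v map_vec int b \<in> H} \<longleftrightarrow> multidegree V w \<in> H"
  proof
    assume "w \<in> mon_of_vec ` {b \<in> carrier_vec s. V *\<^sub>v map_vec int b \<in> H}"
    then show "multidegree V w \<in> H"
      using V by (auto simp: multidegree_def vec_of_mon_of_vec)
  next
    assume "multidegree V w \<in> H"
    then have "vec_of_mon s w \<in> {b \<in> carrier_vec s. V *\<^sub>v map_vec int b \<in> H}"
      using V by (auto simp: multidegree_def vec_of_mon_def)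
    then show "w \<in> mon_of_vec ` {b \<in> carrier_vec s. V *\<^sub>v map_vec int b \<in> H}"
      using mon_of_vec_of_mon[OF w] by force
  qed
  then show ?thesis
    by (simp only: semigroup_generated_monomials[OF a inj, symmetric] gen)
qed

section \<open>The pulled back term order\<close>

definition pullback_order :: "nat \<Rightarrow> (mon \<Rightarrow> mon) \<Rightarrow> mon rel \<Rightarrow> mon rel \<Rightarrow> mon rel" where
  "pullback_order r h ord1 ord2 =
     {(u, v). u \<in> monomials r \<and> v \<in> monomials r \<and>
        (if h u = h v then (u, v) \<in> ord2 else (h u, h v) \<in> ord1)}"

text \<open>
  Comparing images under an additive map alone is only a preorder; the second order makes it
  antisymmetric. Compatibility with addition uses that addition of exponents is cancellative, so that
  two images differ before adding \<open>w\<close> if and only if they differ afterwards.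
\<close>

lemma term_order_pullback:
  assumes ord1: "term_order s ord1" and ord2: "term_order r ord2"
    and h: "\<And>u. u \<in> monomials r \<Longrightarrow> h u \<in> monomials s"
    and h0: "h 0 = 0" and hadd: "\<And>u v. h (u + v) = h u + h v"
  shows "term_order r (pullback_order r h ord1 ord2)"
  unfolding term_order_def linear_order_on_def partial_order_on_def preorder_on_def
proof (intro conjI ballI impI)
  let ?o = "pullback_order r h ord1 ord2"
  show "?o \<subseteq> monomials r \<times> monomials r"
    by (auto simp: pullback_order_def)
  show "refl_on (monomials r) ?o"
    using term_order_refl[OF ord2] by (auto simp: refl_on_def pullback_order_def)
  show "trans ?o"
  proof (rule transI)
    fix u v w assume uv: "(u, v) \<in> ?o" and vw: "(v, w) \<in> ?o"
    consider "h u = h v" "h v = h w" | "h u = h v" "h v \<noteq> h w" | "h u \<noteq> h v" "h v = h w"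
      | "h u \<noteq> h v" "h v \<noteq> h w" by blast
    then show "(u, w) \<in> ?o"
    proof cases
      case 4
      then have *: "(h u, h v) \<in> ord1" "(h v, h w) \<in> ord1"
        using uv vw by (auto simp: pullback_order_def)
      then have "h u \<noteq> h w" using term_order_antisym[OF ord1] 4 by metis
      with * show ?thesis
        using uv vw term_order_trans[OF ord1] by (auto simp: pullback_order_def)
    qed (use uv vw term_order_trans[OF ord2] in \<open>auto simp: pullback_order_def\<close>)
  qed
  show "antisym ?o"
    using term_order_antisym[OF ord1] term_order_antisym[OF ord2]
    by (intro antisymI) (auto simp: pullback_order_def split: if_splits)
  show "total_on (monomials r) ?o"
    using term_order_total[OF ord2] term_order_total[OF ord1] h
    by (fastforce simp: total_on_def pullback_order_def)
  show "(0, u) \<in> ?o" if "u \<in> monomials r" for u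
    using that term_order_zero[OF ord1 h[OF that]] term_order_zero[OF ord2 that]
    by (simp add: pullback_order_def h0 monomials_zero)
  show "(u + w, v + w) \<in> ?o"
    if "u \<in> monomials r" "v \<in> monomials r" "w \<in> monomials r" "(u, v) \<in> ?o" for u v w
    using that term_order_add[OF ord1 _ h[of w]] term_order_add[OF ord2, of u v w]
    by (auto simp: pullback_order_def hadd monomials_add split: if_splits)
qed

section \<open>Leading monomials of the preimage\<close>

lemma toric_preimage_memI:
  assumes "Poly_Mapping.keys f \<subseteq> monomials r" "toric_hom a f \<in> I"
  shows "f \<in> toric_preimage r a I"
  using assms by (simp add: toric_preimage_def)

text \<open>
  The terms of \<open>f\<close> with the same image as the leading monomial \<open>u\<close> are compared by \<open>ord2\<close>, the other
  ones have an image that is smaller for \<open>ord1\<close>. Either the former cancel under \<open>\<phi>\<close> and give an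
  element of the toric ideal led by \<open>u\<close>, or the image of \<open>u\<close> leads \<open>\<phi>(f)\<close>.
\<close>

lemma lead_monomials_toric_preimage_cases:
  fixes I :: "'k::field mpoly set"
  assumes u: "u \<in> lead_monomials (pullback_order r (toric_exponent a) ord1 ord2) (toric_preimage r a I)"
    and ord1: "term_order s ord1"
    and a: "a ` {..<r} \<subseteq> carrier_vec s"
  shows "u \<in> lead_monomials ord2 (toric_ideal r s a :: 'k mpoly set) \<or>
    toric_exponent a u \<in> lead_monomials ord1 I"
proof -
  let ?h = "toric_exponent a"
  let ?w = "?h u"
  obtain f where f: "Poly_Mapping.keys f \<subseteq> monomials r" "toric_hom a f \<in> I"
    and uf: "u \<in> Poly_Mapping.keys f"
    and max: "\<And>v. v \<in> Poly_Mapping.keys f \<Longrightarrow> (v, u) \<in> pullback_order r ?h ord1 ord2"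
    using u by (auto simp: lead_monomials_def toric_preimage_def is_lead_mon_def)
  show ?thesis
  proof (cases "Poly_Mapping.lookup (toric_hom a f) ?w = 0")
    case True
    define g where "g = restrict_poly {v. ?h v = ?w} f"
    have "toric_hom a g = 0"
      using True by (simp add: g_def toric_hom_restrict_fibre)
    then have "g \<in> toric_ideal r s a"
      unfolding toric_ideal_eq_preimage
      by (intro toric_preimage_memI) (use f(1) in \<open>auto simp: g_def keys_restrict_poly\<close>)
    moreover have "is_lead_mon ord2 g u"
      using uf max by (auto simp: is_lead_mon_def g_def keys_restrict_poly pullback_order_def)
    ultimately show ?thesis by (auto simp: lead_monomials_def)
  next
    case False
    have "(w, ?w) \<in> ord1" if w: "w \<in> Poly_Mapping.keys (toric_hom a f)" for w
    proof -
      obtain v where v: "v \<in> Poly_Mapping.keys f" "w = ?h v"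
        using w keys_toric_hom[of a f] by blast
      show ?thesis
      proof (cases "w = ?w")
        case True
        have "u \<in> monomials r" using f(1) uf by auto
        then show ?thesis
          using True toric_exponent_in_monomials[OF a] term_order_refl[OF ord1] by simp
      qed (use max[OF v(1)] v(2) in \<open>auto simp: pullback_order_def\<close>)
    qed
    with False have "is_lead_mon ord1 (toric_hom a f) ?w"
      by (simp add: is_lead_mon_def in_keys_iff)
    with f(2) show ?thesis by (auto simp: lead_monomials_def)
  qed
qed

text \<open>
  An element of the toric ideal may be cut down to the terms with the same image as its leading
  monomial: it stays in the kernel, and on such terms the pulled back order agrees with \<open>ord2\<close>.
\<close>

lemma lead_monomials_toric_ideal_subset:
  fixes I :: "'k::field mpoly set"
  assumes u: "u \<in> lead_monomials ord2 (toric_ideal r s a :: 'k mpoly set)"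
    and I: "ideal I (mpoly_ring s)"
  shows "u \<in> lead_monomials (pullback_order r (toric_exponent a) ord1 ord2) (toric_preimage r a I)"
proof -
  let ?h = "toric_exponent a"
  obtain f :: "'k mpoly" where f: "Poly_Mapping.keys f \<subseteq> monomials r" "toric_hom a f = 0"
    and lead: "is_lead_mon ord2 f u"
    using u by (auto simp: lead_monomials_def toric_ideal_eq_preimage toric_preimage_def)
  define g where "g = restrict_poly {v. ?h v = ?h u} f"
  have "toric_hom a g = 0"
    using f(2) by (simp add: g_def toric_hom_restrict_fibre)
  then have "toric_hom a g \<in> I"
    using additive_subgroup.zero_closed[OF ideal.axioms(1)[OF I]] by simp
  then have "g \<in> toric_preimage r a I"
    by (intro toric_preimage_memI) (use f(1) in \<open>auto simp: g_def keys_restrict_poly\<close>)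
  moreover have "is_lead_mon (pullback_order r ?h ord1 ord2) g u"
    using lead f(1) by (auto simp: is_lead_mon_def g_def keys_restrict_poly pullback_order_def)
  ultimately show ?thesis by (auto simp: lead_monomials_def)
qed

text \<open>
  Lifting each monomial of \<open>g\<close> separately gives a preimage without cancellation. The lift of one
  monomial may be prescribed, which allows \<open>u\<close> to become the leading monomial.
\<close>

lemma toric_lift_exists:
  fixes g :: "'k::field mpoly"
  assumes g: "Poly_Mapping.keys g \<subseteq> toric_exponent a ` monomials r"
    and u: "u \<in> monomials r" "toric_exponent a u \<in> Poly_Mapping.keys g"
  obtains f where "Poly_Mapping.keys f \<subseteq> monomials r" "toric_hom a f = g"
    "u \<in> Poly_Mapping.keys f" "inj_on (toric_exponent a) (Poly_Mapping.keys f)"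
    "toric_exponent a ` Poly_Mapping.keys f \<subseteq> Poly_Mapping.keys g"
proof -
  let ?h = "toric_exponent a"
  \<comment> \<open>The lift of \<open>\<phi>(u)\<close> is chosen to be \<open>u\<close>, all others are arbitrary.\<close>
  define \<sigma> where "\<sigma> w = (if w = ?h u then u else inv_into (monomials r) ?h w)" for w
  have \<sigma>: "\<sigma> w \<in> monomials r" "?h (\<sigma> w) = w" if "w \<in> Poly_Mapping.keys g" for w
    using that g u by (auto simp: \<sigma>_def f_inv_into_f intro!: inv_into_into)
  define f where "f = (\<Sum>w\<in>Poly_Mapping.keys g. Poly_Mapping.single (\<sigma> w) (Poly_Mapping.lookup g w))"
  have kf: "Poly_Mapping.keys f \<subseteq> \<sigma> ` Poly_Mapping.keys g"
    unfolding f_def by (rule order_trans[OF keys_sum]) (auto split: if_splits)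
  have "toric_hom a f = (\<Sum>w\<in>Poly_Mapping.keys g. Poly_Mapping.single w (Poly_Mapping.lookup g w))"
    unfolding f_def toric_hom_sum toric_hom_single by (intro sum.cong refl) (simp add: \<sigma>)
  then have tf: "toric_hom a f = g"
    using poly_mapping_sum_single[of g] by simp
  have "?h u \<in> ?h ` Poly_Mapping.keys f"
    using keys_toric_hom[of a f] u(2) tf by blast
  then obtain v where v: "v \<in> Poly_Mapping.keys f" "?h v = ?h u" by auto
  then obtain w where "w \<in> Poly_Mapping.keys g" "v = \<sigma> w" using kf by blast
  with v \<sigma> have "v = u" by (simp add: \<sigma>_def)
  with v have uf: "u \<in> Poly_Mapping.keys f" by simp
  show thesis
  proof (rule that[OF _ tf uf])
    show "inj_on ?h (Poly_Mapping.keys f)"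
      using kf \<sigma>(2) by (intro inj_on_subset[OF _ kf] inj_onI) auto
  qed (use kf \<sigma> in auto)
qed

text \<open>
  Taking the homogeneous component of \<open>g\<close> in the degree of \<open>\<phi>(u)\<close> keeps the leading monomial, stays
  inside \<open>I\<close> because \<open>I\<close> is graded, and leaves only monomials in the image of \<open>\<phi>\<close>, since one
  monomial of that degree is in the image. In a lift without cancellation distinct terms have distinct
  images, so the order of the terms is that of \<open>g\<close>.
\<close>

lemma lead_monomials_pullback_subset:
  fixes I :: "'k::field mpoly set"
  assumes V: "V \<in> carrier_mat d s" and a: "a ` {..<r} \<subseteq> carrier_vec s" and inj: "inj_on a {..<r}"
    and gen: "semigroup_generated s (a ` {..<r}) = {b \<in> carrier_vec s. V *\<^sub>v map_vec int b \<in> H}"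
    and I: "graded_ideal V I"
    and ord2: "term_order r ord2"
    and u: "u \<in> monomials r" "toric_exponent a u \<in> lead_monomials ord1 I"
  shows "u \<in> lead_monomials (pullback_order r (toric_exponent a) ord1 ord2) (toric_preimage r a I)"
proof -
  let ?h = "toric_exponent a"
  obtain g where g: "g \<in> I" "is_lead_mon ord1 g (?h u)"
    using u(2) by (auto simp: lead_monomials_def)
  have idI: "ideal I (mpoly_ring s)" using I V by (simp add: graded_ideal_def)
  have "multidegree V (?h u) \<in> carrier_vec (dim_row V)"
    unfolding multidegree_def by (rule mult_mat_vec_carrier[OF carrier_matI]) (simp_all add: vec_of_mon_def)
  then have g': "restrict_poly {w. multidegree V w = multidegree V (?h u)} g \<in> I" (is "?g \<in> I")
    using I g(1) by (simp add: graded_ideal_def homogeneous_component_eq)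
  have kg: "Poly_Mapping.keys ?g \<subseteq> monomials s"
    using ideal_subset_mpoly[OF idI g'] .
  note iff = toric_exponent_image_iff[OF V a inj gen]
  have "multidegree V (?h u) \<in> H"
    using iff toric_exponent_in_monomials[OF a u(1)] u(1) by blast
  then have img: "Poly_Mapping.keys ?g \<subseteq> ?h ` monomials r"
    using iff kg by (auto simp: keys_restrict_poly)
  have "?h u \<in> Poly_Mapping.keys ?g"
    using g(2) by (simp add: is_lead_mon_def keys_restrict_poly)
  then obtain f where f: "Poly_Mapping.keys f \<subseteq> monomials r" "toric_hom a f = ?g"
    "u \<in> Poly_Mapping.keys f" "inj_on ?h (Poly_Mapping.keys f)"
    "?h ` Poly_Mapping.keys f \<subseteq> Poly_Mapping.keys ?g"
    using toric_lift_exists[OF img u(1)] by blast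
  have "is_lead_mon (pullback_order r ?h ord1 ord2) f u"
    unfolding is_lead_mon_def
  proof (intro conjI ballI f(3))
    fix v assume v: "v \<in> Poly_Mapping.keys f"
    show "(v, u) \<in> pullback_order r ?h ord1 ord2"
    proof (cases "?h v = ?h u")
      case True
      then have "v = u" using f(4) v f(3) by (auto dest: inj_onD)
      then show ?thesis using u(1) term_order_refl[OF ord2] by (simp add: pullback_order_def)
    next
      case False
      have "?h v \<in> Poly_Mapping.keys g" using f(5) v by (auto simp: keys_restrict_poly)
      then show ?thesis
        using False g(2) v f(1) u(1) by (auto simp: pullback_order_def is_lead_mon_def)
    qed
  qed
  moreover have "f \<in> toric_preimage r a I"
    using f g' by (intro toric_preimage_memI) auto
  ultimately show ?thesis by (auto simp: lead_monomials_def)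
qed

section \<open>Covering a monomial by the image of a divisor\<close>

lemma toric_exponent_pos_iff:
  "0 < Poly_Mapping.lookup (toric_exponent a u) i \<longleftrightarrow>
     (\<exists>j\<in>Poly_Mapping.keys u. 0 < Poly_Mapping.lookup (mon_of_vec (a j)) i)"
  unfolding lookup_toric_exponent neq0_conv[symmetric] by (auto simp: in_keys_iff)

text \<open>
  Remove one variable \<open>y\<^sub>i\<close> from \<open>v\<close> and cover the rest by a divisor \<open>u'\<close> of \<open>u\<close>. If this does not
  already cover \<open>v\<close>, then only the exponent of \<open>y\<^sub>i\<close> is short, by one. As \<open>\<phi>(u)\<close> has enough of
  \<open>y\<^sub>i\<close>, some variable of \<open>u / u'\<close> has an image divisible by \<open>y\<^sub>i\<close>, and multiplying \<open>u'\<close>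
  by it is enough.
\<close>

lemma cover_by_small_divisor:
  assumes "mon_dvd v (toric_exponent a u)"
  shows "\<exists>u'. mon_dvd u' u \<and> mon_dvd v (toric_exponent a u') \<and> mon_degree u' \<le> mon_degree v"
  using assms
proof (induction "mon_degree v" arbitrary: v)
  case 0
  then have "v = 0" using mon_degree_eq_0_iff by simp
  then show ?case
    by (intro exI[of _ 0]) (simp add: mon_dvd_iff mon_degree_def)
next
  case (Suc k)
  have "v \<noteq> 0" using Suc.hyps(2) mon_degree_eq_0_iff[of v] by auto
  then obtain i where "i \<in> Poly_Mapping.keys v" by fastforce
  then have "mon_dvd (Poly_Mapping.single i 1) v"
    by (auto simp: mon_dvd_iff lookup_single when_def in_keys_iff)
  then obtain v' where v: "v = Poly_Mapping.single i 1 + v'" by (auto simp: mon_dvd_def)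
  have deg1: "mon_degree (Poly_Mapping.single j 1) = 1" for j
    by (simp add: mon_degree_def)
  have "k = mon_degree v'" using Suc.hyps(2) by (simp add: v mon_degree_add deg1[simplified])
  moreover have "mon_dvd v' (toric_exponent a u)"
    using Suc.prems unfolding v mon_dvd_iff lookup_add by (meson add_leD2)
  ultimately obtain u' where u': "mon_dvd u' u" "mon_dvd v' (toric_exponent a u')" "mon_degree u' \<le> k"
    using Suc.hyps(1) by blast
  show ?case
  proof (cases "mon_dvd v (toric_exponent a u')")
    case True
    then show ?thesis using u' Suc.hyps(2) by (metis le_SucI)
  next
    case False
    then obtain l where "Poly_Mapping.lookup (toric_exponent a u') l < Poly_Mapping.lookup v l"
      by (auto simp: mon_dvd_iff not_le)
    moreover have "Poly_Mapping.lookup v' l \<le> Poly_Mapping.lookup (toric_exponent a u') l"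
      using u'(2) by (simp add: mon_dvd_iff)
    ultimately have less: "Poly_Mapping.lookup (toric_exponent a u') i < Poly_Mapping.lookup v i"
      by (auto simp: v lookup_add lookup_single when_def split: if_splits)
    \<comment> \<open>The complementary factor \<open>w\<close> supplies the missing variable.\<close>
    obtain w where w: "u = u' + w" using u'(1) by (auto simp: mon_dvd_def)
    have "Poly_Mapping.lookup v i \<le> Poly_Mapping.lookup (toric_exponent a u) i"
      using Suc.prems by (simp add: mon_dvd_iff)
    with less have "0 < Poly_Mapping.lookup (toric_exponent a w) i"
      by (simp add: w toric_exponent_add lookup_add)
    then obtain j where j: "j \<in> Poly_Mapping.keys w" "0 < Poly_Mapping.lookup (mon_of_vec (a j)) i"
      by (auto simp: toric_exponent_pos_iff)
    let ?u = "u' + Poly_Mapping.single j 1"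
    have "mon_dvd ?u u"
      using j(1) by (auto simp: w mon_dvd_iff lookup_add lookup_single when_def in_keys_iff)
    moreover have "mon_dvd v (toric_exponent a ?u)"
      unfolding mon_dvd_iff
    proof
      fix x
      have "Poly_Mapping.lookup v' x \<le> Poly_Mapping.lookup (toric_exponent a u') x"
        using u'(2) by (simp add: mon_dvd_iff)
      then show "Poly_Mapping.lookup v x \<le> Poly_Mapping.lookup (toric_exponent a ?u) x"
        using j(2) unfolding toric_exponent_add toric_exponent_var
        by (auto simp: v lookup_add lookup_single when_def)
    qed
    moreover have "mon_degree ?u \<le> mon_degree v"
      using u'(3) Suc.hyps(2) by (simp add: mon_degree_add deg1[simplified])
    ultimately show ?thesis by blast
  qed
qed

definition mon_radical :: "mon \<Rightarrow> mon" where
  "mon_radical u = (\<Sum>j\<in>Poly_Mapping.keys u. Poly_Mapping.single j 1)"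

lemma lookup_mon_radical:
  "Poly_Mapping.lookup (mon_radical u) j = (if j \<in> Poly_Mapping.keys u then 1 else 0)"
  by (simp add: mon_radical_def lookup_sum lookup_single when_def)

text \<open>
  The support of \<open>\<phi>(u)\<close> depends only on the support of \<open>u\<close>, and for square-free \<open>v\<close> divisibility only
  asks for containment of supports.
\<close>

lemma cover_by_radical:
  assumes "mon_squarefree v" "mon_dvd v (toric_exponent a u)"
  shows "mon_dvd (mon_radical u) u" "mon_dvd v (toric_exponent a (mon_radical u))"
    "mon_squarefree (mon_radical u)"
proof -
  have keys: "Poly_Mapping.keys (mon_radical u) = Poly_Mapping.keys u"
    by (auto simp: in_keys_iff lookup_mon_radical split: if_splits)
  show "mon_dvd (mon_radical u) u"
    by (auto simp: mon_dvd_iff lookup_mon_radical in_keys_iff)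
  show "mon_squarefree (mon_radical u)"
    by (simp add: mon_squarefree_def lookup_mon_radical)
  show "mon_dvd v (toric_exponent a (mon_radical u))"
    unfolding mon_dvd_iff
  proof
    fix i
    have "Poly_Mapping.lookup v i \<le> 1"
      and "Poly_Mapping.lookup v i \<le> Poly_Mapping.lookup (toric_exponent a u) i"
      using assms by (simp_all add: mon_squarefree_def mon_dvd_iff)
    moreover have "0 < Poly_Mapping.lookup (toric_exponent a u) i \<longleftrightarrow>
        0 < Poly_Mapping.lookup (toric_exponent a (mon_radical u)) i"
      by (simp only: toric_exponent_pos_iff keys)
    ultimately show "Poly_Mapping.lookup v i \<le> Poly_Mapping.lookup (toric_exponent a (mon_radical u)) i"
      by linarith
  qed
qed

section \<open>Transfer of initial ideals\<close>

text \<open>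
  The common form of both parts of the theorem. A leading monomial of the preimage that comes from the
  toric ideal has a good divisor there. If instead \<open>\<phi>(u)\<close> is a leading monomial of \<open>I\<close>, then a good
  divisor \<open>v\<close> of \<open>\<phi>(u)\<close> is transported back by the hypothesis \<open>cover\<close>: \<open>\<phi>(u')\<close> is a multiple of
  \<open>v\<close>, hence again a leading monomial of \<open>I\<close>, and so \<open>u'\<close> is a leading monomial of the preimage.
\<close>

lemma admits_initial_ideal_toric_preimage:
  fixes I :: "'k::field mpoly set"
  assumes V: "V \<in> carrier_mat d s" and a: "a ` {..<r} \<subseteq> carrier_vec s" and inj: "inj_on a {..<r}"
    and gen: "semigroup_generated s (a ` {..<r}) = {b \<in> carrier_vec s. V *\<^sub>v map_vec int b \<in> H}"
    and I: "graded_ideal V I"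
    and cover: "\<And>u v. P v \<Longrightarrow> mon_dvd v (toric_exponent a u) \<Longrightarrow>
      \<exists>u'. mon_dvd u' u \<and> mon_dvd v (toric_exponent a u') \<and> P u'"
    and Q: "\<And>n (M :: 'k mpoly set). Q n M \<longleftrightarrow> (\<exists>G. minimal_monomial_generators n M G \<and> (\<forall>u\<in>G. P u))"
    and admI: "admits_initial_ideal s (Q s) I"
    and admP: "admits_initial_ideal r (Q r) (toric_ideal r s a :: 'k mpoly set)"
  shows "admits_initial_ideal r (Q r) (toric_preimage r a I)"
proof -
  have idI: "ideal I (mpoly_ring s)" using I V by (simp add: graded_ideal_def)
  note idP = toric_ideal_ideal[OF a, where 'k = 'k]
  note idJ = toric_preimage_ideal[OF a idI]
  obtain ord1 where ord1: "term_order s ord1" and Q1: "Q s (initial_ideal s ord1 I)"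
    using admI by (auto simp: admits_initial_ideal_def)
  obtain ord2 where ord2: "term_order r ord2"
    and Q2: "Q r (initial_ideal r ord2 (toric_ideal r s a :: 'k mpoly set))"
    using admP by (auto simp: admits_initial_ideal_def)
  let ?h = "toric_exponent a"
  let ?ord = "pullback_order r ?h ord1 ord2"
  let ?L1 = "lead_monomials ord1 I"
  let ?L2 = "lead_monomials ord2 (toric_ideal r s a :: 'k mpoly set)"
  let ?L = "lead_monomials ?ord (toric_preimage r a I)"
  have ord: "term_order r ?ord"
    by (rule term_order_pullback[OF ord1 ord2])
      (use toric_exponent_in_monomials[OF a] in \<open>auto simp: toric_exponent_zero toric_exponent_add\<close>)
  have L1: "\<forall>w\<in>?L1. \<exists>v\<in>?L1. mon_dvd v w \<and> P v"
    using Q1 by (simp only: Q minimal_generators_initial_ideal_iff[OF ord1 idI])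
  have L2: "\<forall>u\<in>?L2. \<exists>v\<in>?L2. mon_dvd v u \<and> P v"
    using Q2 by (simp only: Q minimal_generators_initial_ideal_iff[OF ord2 idP])
  have "\<exists>u'\<in>?L. mon_dvd u' u \<and> P u'" if u: "u \<in> ?L" for u
  proof -
    have ur: "u \<in> monomials r" using u lead_monomials_subset[OF idJ] by blast
    consider "u \<in> ?L2" | "?h u \<in> ?L1"
      using lead_monomials_toric_preimage_cases[OF u ord1 a] by blast
    then show ?thesis
    proof cases
      case 1
      then show ?thesis using L2 lead_monomials_toric_ideal_subset[OF _ idI] by blast
    next
      case 2
      then obtain v where v: "v \<in> ?L1" "mon_dvd v (?h u)" "P v" using L1 by blast
      then obtain u' where u': "mon_dvd u' u" "mon_dvd v (?h u')" "P u'" using cover by blast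
      have u'r: "u' \<in> monomials r" using mon_dvd_monomials[OF u'(1) ur] .
      have "?h u' \<in> ?L1"
        by (rule lead_monomials_dvd[OF ord1 idI v(1) u'(2) toric_exponent_in_monomials[OF a u'r]])
      then have "u' \<in> ?L"
        by (rule lead_monomials_pullback_subset[OF V a inj gen I ord2 u'r])
      with u' show ?thesis by blast
    qed
  qed
  then have "Q r (initial_ideal r ?ord (toric_preimage r a I))"
    by (simp only: Q minimal_generators_initial_ideal_iff[OF ord idJ]) blast
  with ord show ?thesis by (auto simp: admits_initial_ideal_def)
qed

theorem theorem1:
  fixes d s r m :: nat
    and V :: "int mat"
    and H :: "int vec set"
    and a :: "nat \<Rightarrow> nat vec"
    and I :: "'k::field mpoly set"
  assumes "V \<in> carrier_mat d s"
    and "finitely_generated_semigroup d H"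
    and "a ` {..<r} \<subseteq> carrier_vec s"
    and "inj_on a {..<r}"
    and "semigroup_generated s (a ` {..<r}) = {b \<in> carrier_vec s. V *\<^sub>v map_vec int b \<in> H}"
    and "graded_ideal V I"
  shows
    "(admits_initial_ideal s (monomial_ideal_of_degree_at_most s m) I \<and>
      admits_initial_ideal r (monomial_ideal_of_degree_at_most r m) (toric_ideal r s a :: 'k mpoly set) \<longrightarrow>
      admits_initial_ideal r (monomial_ideal_of_degree_at_most r m) (toric_preimage r a I)) \<and>
     (admits_initial_ideal s (squarefree_monomial_ideal s) I \<and>
      admits_initial_ideal r (squarefree_monomial_ideal r) (toric_ideal r s a :: 'k mpoly set) \<longrightarrow>
      admits_initial_ideal r (squarefree_monomial_ideal r) (toric_preimage r a I))"
proof -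
  note transfer = admits_initial_ideal_toric_preimage[OF assms(1,3-6)]
  show ?thesis
  proof (intro conjI impI; elim conjE)
    assume "admits_initial_ideal s (monomial_ideal_of_degree_at_most s m) I"
      and "admits_initial_ideal r (monomial_ideal_of_degree_at_most r m) (toric_ideal r s a :: 'k mpoly set)"
    then show "admits_initial_ideal r (monomial_ideal_of_degree_at_most r m) (toric_preimage r a I)"
    proof (rule transfer[where P = "\<lambda>u. mon_degree u \<le> m" and Q = "\<lambda>n. monomial_ideal_of_degree_at_most n m", rotated 2])
      fix u v assume "mon_degree v \<le> m" "mon_dvd v (toric_exponent a u)"
      then show "\<exists>u'. mon_dvd u' u \<and> mon_dvd v (toric_exponent a u') \<and> mon_degree u' \<le> m"
        using cover_by_small_divisor[of v a u] le_trans by blast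
    qed (rule monomial_ideal_of_degree_at_most_def)
  next
    assume "admits_initial_ideal s (squarefree_monomial_ideal s) I"
      and "admits_initial_ideal r (squarefree_monomial_ideal r) (toric_ideal r s a :: 'k mpoly set)"
    then show "admits_initial_ideal r (squarefree_monomial_ideal r) (toric_preimage r a I)"
    proof (rule transfer[where P = mon_squarefree and Q = squarefree_monomial_ideal, rotated 2])
      fix u v assume "mon_squarefree v" "mon_dvd v (toric_exponent a u)"
      then show "\<exists>u'. mon_dvd u' u \<and> mon_dvd v (toric_exponent a u') \<and> mon_squarefree u'"
        using cover_by_radical[of v a u] by blast
    qed (rule squarefree_monomial_ideal_def)
  qed
qed

end
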